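(* Let $M$ be a non-Hausdorff $1$-manifold and let $x\in M$ be such that for each $y_0,y_1\in NH(x)$ there is a homeomorphism $h$ of $M$ (onto itself) with $h(x)=x$ and $h(y_0)=y_1$. Then $NH(x)$ is discrete (if non-empty).
   Context: A $1$-manifold is a connected topological space each of whose points has a neighborhood homeomorphic to $\mathbb{R}$ (not assumed Hausdorff); it is non-Hausdorff if at least two of its points cannot be separated, i.e. do not have disjoint open neighborhoods. $NH(x)$ is the set of points $y\neq x$ of $M$ which cannot be separated from $x$. Discreteness is with respect to the subspace topology. *)

theory Defs
  imports "HOL-Analysis.Analysis"
begin

(* A neighborhood N of x need not be open: it only has to contain an open set around x.
   Neither the Hausdorff property nor second countability is required. *)
definition one_manifold :: "'a topology \<Rightarrow> bool" where
  "one_manifold M \<longleftrightarrow> connected_space M \<and>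
     (\<forall>x \<in> topspace M. \<exists>U N. openin M U \<and> x \<in> U \<and> U \<subseteq> N \<and> N \<subseteq> topspace M \<and>
        subtopology M N homeomorphic_space euclideanreal)"

definition separable_points :: "'a topology \<Rightarrow> 'a \<Rightarrow> 'a \<Rightarrow> bool" where
  "separable_points M x y \<longleftrightarrow>
     (\<exists>U V. openin M U \<and> openin M V \<and> x \<in> U \<and> y \<in> V \<and> disjnt U V)"

definition NH :: "'a topology \<Rightarrow> 'a \<Rightarrow> 'a set" where
  "NH M x = {y \<in> topspace M. y \<noteq> x \<and> \<not> separable_points M x y}"

end

theory Submission
  imports Defs
begin

text \<open>
  The set \<open>NH M x\<close> is closed in \<open>M\<close> and contains no chart: if a chart around a point of
  \<open>NH M x\<close> is given, it meets every chart around \<open>x\<close>, and the points of the latter other than \<open>x\<close>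
  are separated from \<open>x\<close>.  Inside a chart, which is a copy of the real line, \<open>NH M x\<close> is therefore a
  closed set that is neither empty nor everything.  Such a set has a boundary point at which a
  complementary interval ends.  This property of a point, called accessibility below, is
  topological, hence it is preserved by the homeomorphisms that act transitively on \<open>NH M x\<close>,
  and all points of \<open>NH M x\<close> have it.

  A subset of the line has only countably many accessible points, since the intervals reaching them
  from outside can be labelled by rationals.  So \<open>NH M x\<close> is countable inside a chart.  A nonempty
  closed countable set of reals is not perfect: it has an isolated point.  Being isolated is again
  preserved by homeomorphisms, so by transitivity every point of \<open>NH M x\<close> is isolated.

  A Cantor set shows why transitivity is essential: it can occur as \<open>NH M x\<close> in some chart, but its
  gap endpoints are accessible and its other points are not.
\<close>

section \<open>Accessible points\<close>

text \<open>
  For a set of reals this says that the point is isolated in the set from the left or from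
  the right.  Requiring \<open>K\<close> inside arbitrarily small \<open>U\<close> makes the notion local, so that it can be
  tested in charts; speaking of connected sets rather than of sides makes it visibly topological.
\<close>

definition accessible_point :: "'a topology \<Rightarrow> 'a set \<Rightarrow> 'a \<Rightarrow> bool" where
  "accessible_point X S y \<longleftrightarrow>
     (\<forall>U. openin X U \<and> y \<in> U \<longrightarrow>
        (\<exists>K. K \<subseteq> U \<and> connectedin X K \<and> y \<in> K \<and> K \<noteq> {y} \<and> K \<inter> S = {y}))"

lemma accessible_point_open_subtopology:
  assumes "openin X W" "y \<in> W"
  shows "accessible_point (subtopology X W) (W \<inter> S) y \<longleftrightarrow> accessible_point X S y"
proof
  assume acc: "accessible_point (subtopology X W) (W \<inter> S) y"
  show "accessible_point X S y"
    unfolding accessible_point_def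
  proof (intro allI impI)
    fix U assume "openin X U \<and> y \<in> U"
    then have "openin (subtopology X W) (U \<inter> W)" "y \<in> U \<inter> W"
      using assms by (auto simp: openin_subtopology)
    then obtain K where "K \<subseteq> U \<inter> W" "connectedin (subtopology X W) K" "y \<in> K" "K \<noteq> {y}"
      "K \<inter> (W \<inter> S) = {y}"
      using acc unfolding accessible_point_def by meson
    then show "\<exists>K. K \<subseteq> U \<and> connectedin X K \<and> y \<in> K \<and> K \<noteq> {y} \<and> K \<inter> S = {y}"
      by (intro exI[of _ K]) (auto simp: connectedin_subtopology)
  qed
next
  assume acc: "accessible_point X S y"
  show "accessible_point (subtopology X W) (W \<inter> S) y"
    unfolding accessible_point_def
  proof (intro allI impI)
    fix U assume U: "openin (subtopology X W) U \<and> y \<in> U"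
    then have "openin X U" "U \<subseteq> W"
      using assms openin_open_subtopology by blast+
    moreover obtain K where "K \<subseteq> U" "connectedin X K" "y \<in> K" "K \<noteq> {y}" "K \<inter> S = {y}"
      using acc U \<open>openin X U\<close> unfolding accessible_point_def by meson
    ultimately show "\<exists>K. K \<subseteq> U \<and> connectedin (subtopology X W) K \<and> y \<in> K \<and> K \<noteq> {y} \<and>
        K \<inter> (W \<inter> S) = {y}"
      by (intro exI[of _ K]) (auto simp: connectedin_subtopology)
  qed
qed

lemma accessible_point_homeomorphic_image:
  assumes h: "homeomorphic_map X Y h" and S: "S \<subseteq> topspace X" and y: "y \<in> topspace X"
    and acc: "accessible_point X S y"
  shows "accessible_point Y (h ` S) (h y)"
  unfolding accessible_point_def
proof (intro allI impI)
  fix U assume U: "openin Y U \<and> h y \<in> U"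
  let ?V = "{z \<in> topspace X. h z \<in> U}"
  have inj: "inj_on h (topspace X)"
    using h by (simp add: homeomorphic_eq_everything_map)
  have "openin X ?V" "y \<in> ?V"
    using U y homeomorphic_imp_continuous_map[OF h] openin_continuous_map_preimage by fastforce+
  then obtain K where K: "K \<subseteq> ?V" "connectedin X K" "y \<in> K" "K \<noteq> {y}" "K \<inter> S = {y}"
    using acc unfolding accessible_point_def by meson
  have KX: "K \<subseteq> topspace X"
    using K(1) by blast
  have "h ` K \<inter> h ` S = {h y}"
    using inj_on_image_Int[OF inj KX S] K(5) by auto
  moreover have "h ` K \<noteq> {h y}"
    using inj_on_image_eq_iff[OF inj KX, of "{y}"] K(4) y by auto
  moreover have "connectedin Y (h ` K)"
    using homeomorphic_map_connectedness[OF h KX] K(2) by blast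
  ultimately show "\<exists>K. K \<subseteq> U \<and> connectedin Y K \<and> h y \<in> K \<and> K \<noteq> {h y} \<and> K \<inter> h ` S = {h y}"
    using K by (intro exI[of _ "h ` K"]) auto
qed

lemma accessible_point_homeomorphic_image_iff:
  assumes h: "homeomorphic_map X Y h" and S: "S \<subseteq> topspace X" and y: "y \<in> topspace X"
  shows "accessible_point Y (h ` S) (h y) \<longleftrightarrow> accessible_point X S y"
proof
  assume acc: "accessible_point Y (h ` S) (h y)"
  obtain g where g: "homeomorphic_maps X Y h g"
    using h homeomorphic_map_maps by blast
  then have "homeomorphic_map Y X g" and gh: "\<And>z. z \<in> topspace X \<Longrightarrow> g (h z) = z"
    by (auto simp: homeomorphic_maps_map homeomorphic_maps_def)
  moreover have "h ` S \<subseteq> topspace Y" "h y \<in> topspace Y"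
    using S y homeomorphic_imp_surjective_map[OF h] by auto
  ultimately have "accessible_point X (g ` h ` S) (g (h y))"
    using accessible_point_homeomorphic_image acc by metis
  moreover have "g ` h ` S = S"
    using gh S by (force simp: image_iff)
  ultimately show "accessible_point X S y"
    using gh y by simp
qed (rule accessible_point_homeomorphic_image[OF assms])

section \<open>Closed subsets of the line\<close>

text \<open>
  A point of \<open>A\<close> nearest to some \<open>s\<close> outside \<open>A\<close> is accessible: the segment joining it to \<open>s\<close>
  cannot meet \<open>A\<close> again.
\<close>

lemma exists_accessible_point_real:
  fixes A :: "real set"
  assumes A: "closed A" "A \<noteq> {}" "A \<noteq> UNIV"
  shows "\<exists>a\<in>A. accessible_point euclideanreal A a"
proof -
  obtain s where s: "s \<notin> A"
    using A(3) by blast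
  obtain a where a: "a \<in> A" and nearest: "\<And>b. b \<in> A \<Longrightarrow> dist s a \<le> dist s b"
    using distance_attains_inf[OF A(1,2)] by metis
  have "a \<noteq> s"
    using a s by blast
  have "accessible_point euclideanreal A a"
    unfolding accessible_point_def
  proof (intro allI impI)
    fix U assume "openin euclideanreal U \<and> a \<in> U"
    then obtain e where e: "e > 0" "ball a e \<subseteq> U"
      using open_contains_ball by (metis open_openin)
    let ?K = "closed_segment a s \<inter> ball a e"
    define d where "d = min (e/2) \<bar>s - a\<bar>"
    have d: "0 < d" "d < e" "d \<le> \<bar>s - a\<bar>"
      using e(1) \<open>a \<noteq> s\<close> by (auto simp: d_def min_def)
    have "a + sgn (s - a) * d \<in> ?K" "a + sgn (s - a) * d \<noteq> a"
      using d by (auto simp: closed_segment_eq_real_ivl dist_real_def sgn_if)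
    then have "?K \<noteq> {a}"
      by blast
    moreover have "connectedin euclideanreal ?K"
      by (simp add: connectedin_iff_connected convex_connected convex_Int)
    moreover have "?K \<inter> A = {a}"
    proof -
      have "b = a" if "b \<in> closed_segment a s" "b \<in> A" for b
        using nearest[OF that(2)] that(1)
        by (auto simp: closed_segment_eq_real_ivl dist_real_def split: if_splits)
      then show ?thesis
        using a e(1) by auto
    qed
    ultimately show "\<exists>K. K \<subseteq> U \<and> connectedin euclideanreal K \<and> a \<in> K \<and> K \<noteq> {a} \<and> K \<inter> A = {a}"
      using e by (intro exI[of _ ?K]) auto
  qed
  then show ?thesis
    using a by blast
qed

text \<open>
  An accessible point is determined by a rational in the connected set reaching it from outside,
  together with the side on which that rational lies.  The side is needed because both ends of one
  gap may be labelled by the same rational.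
\<close>

lemma countable_accessible_points_real:
  fixes A :: "real set"
  shows "countable {a \<in> A. accessible_point euclideanreal A a}"
proof -
  let ?B = "{a \<in> A. accessible_point euclideanreal A a}"
  have "\<exists>q\<in>\<rat>. q \<noteq> a \<and> closed_segment a q \<inter> A = {a}" if "a \<in> ?B" for a
  proof -
    have "openin euclideanreal UNIV" "accessible_point euclideanreal A a"
      using that by simp_all
    then obtain K where "connectedin euclideanreal K" and K: "a \<in> K" "K \<noteq> {a}" "K \<inter> A = {a}"
      unfolding accessible_point_def by blast
    then have "connected K"
      by simp
    obtain s where s: "s \<in> K" "s \<noteq> a"
      using K(1,2) by blast
    then have "min a s < max a s"
      by linarith
    then obtain q where q: "q \<in> \<rat>" "min a s < q" "q < max a s"
      using Rats_dense_in_real by blast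
    have "q \<in> closed_segment a s"
      using q(2,3) by (cases "a \<le> s") (auto simp: closed_segment_eq_real_ivl)
    then have "closed_segment a q \<subseteq> closed_segment a s"
      by (simp add: subset_closed_segment)
    also have "closed_segment a s \<subseteq> K"
      using \<open>connected K\<close> K(1) s(1)
      by (meson closed_segment_subset is_interval_connected_1 is_interval_convex)
    finally have "closed_segment a q \<inter> A = {a}"
      using K(1,3) by auto
    moreover have "q \<noteq> a"
      using q(2,3) by linarith
    ultimately show ?thesis
      using q(1) by blast
  qed
  then obtain q where q: "\<And>a. a \<in> ?B \<Longrightarrow> q a \<in> \<rat> \<and> q a \<noteq> a \<and> closed_segment a (q a) \<inter> A = {a}"
    by metis
  have inj: "inj_on (\<lambda>a. (q a, q a < a)) ?B"
  proof (rule inj_onI)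
    fix a b
    assume ab: "a \<in> ?B" "b \<in> ?B" and eq: "(q a, q a < a) = (q b, q b < b)"
    have seg: "closed_segment a (q a) \<inter> A = {a}" "closed_segment b (q b) \<inter> A = {b}"
      using q ab by blast+
    have "q a = q b" "q a < a \<longleftrightarrow> q b < b"
      using eq by (metis prod.inject)+
    then have "a \<in> closed_segment b (q b) \<or> b \<in> closed_segment a (q a)"
      by (auto simp: closed_segment_eq_real_ivl)
    moreover have "a \<in> A" "b \<in> A"
      using ab by simp_all
    ultimately have "a \<in> {b} \<or> b \<in> {a}"
      unfolding seg[symmetric] by blast
    then show "a = b"
      by blast
  qed
  have "(\<lambda>a. (q a, q a < a)) ` ?B \<subseteq> \<rat> \<times> UNIV"
    using q by auto
  moreover have "countable (\<rat> \<times> (UNIV :: bool set) :: (real \<times> bool) set)"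
    by (intro countable_SIGMA countable_rat) auto
  ultimately have "countable ((\<lambda>a. (q a, q a < a)) ` ?B)"
    by (rule countable_subset)
  then show ?thesis
    using inj by (rule countable_image_inj_on)
qed

text \<open>Otherwise the set would be perfect and have the cardinality of the continuum.\<close>

lemma countable_closed_real_has_isolated_point:
  fixes A :: "real set"
  assumes "closed A" "countable A" "A \<noteq> {}"
  shows "\<not> A \<subseteq> euclideanreal derived_set_of A"
proof
  assume "A \<subseteq> euclideanreal derived_set_of A"
  moreover have "euclideanreal derived_set_of A \<subseteq> A"
    using assms(1) closedin_contains_derived_set[of euclideanreal A] by simp
  ultimately have "euclideanreal derived_set_of A = A"
    by blast
  then have "(UNIV :: real set) \<lesssim> A"
    using assms(3) completely_metrizable_space_euclidean lepoll_perfect_set by blast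
  then have "countable (UNIV :: real set)"
    using assms(2) countable_lepoll by blast
  then show False
    using uncountable_UNIV_real by blast
qed

section \<open>Charts and inseparable points\<close>

text \<open>
  The neighbourhood supplied by the definition need not be open; the preimage of a small interval
  under its coordinate is, and an open interval is again a line.
\<close>

lemma one_manifold_open_chart:
  assumes M: "one_manifold M" and y: "y \<in> topspace M"
  obtains W f where "openin M W" "y \<in> W" "homeomorphic_map (subtopology M W) euclideanreal f"
proof -
  obtain U N where U: "openin M U" "y \<in> U" "U \<subseteq> N" "N \<subseteq> topspace M"
    and "subtopology M N homeomorphic_space euclideanreal"
    using M y unfolding one_manifold_def by meson
  then obtain g where g: "homeomorphic_map (subtopology M N) euclideanreal g"
    using homeomorphic_space by blast
  have N: "topspace (subtopology M N) = N"
    using U(4) by auto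
  have inj: "inj_on g N"
    using g N by (simp add: homeomorphic_eq_everything_map)
  have "openin (subtopology M N) U"
    using U(1,3) by (auto simp: openin_subtopology)
  then have "open (g ` U)"
    using homeomorphic_map_openness[OF g, of U] U(3) unfolding N by simp
  then obtain e where e: "e > 0" "ball (g y) e \<subseteq> g ` U"
    using U(2) open_contains_ball by (metis imageI)
  define W where "W = {z \<in> N. g z \<in> ball (g y) e}"
  have "W \<subseteq> U"
    using e(2) inj U(3) unfolding W_def by (smt (verit) image_iff inj_onD mem_Collect_eq subsetD subsetI)
  have "openin (subtopology M N) W"
    using openin_continuous_map_preimage[OF homeomorphic_imp_continuous_map[OF g], of "ball (g y) e"]
    unfolding N W_def by simp
  then obtain T where "openin M T" "W = T \<inter> N"
    by (auto simp: openin_subtopology)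
  then have "W = T \<inter> U"
    using \<open>W \<subseteq> U\<close> U(3) by blast
  then have W: "openin M W" "y \<in> W"
    using \<open>openin M T\<close> U e(1) by (auto simp: W_def)
  have "g ` N = UNIV"
    using homeomorphic_imp_surjective_map[OF g] N by simp
  then have "g ` W = ball (g y) e"
    unfolding W_def by (auto simp: image_iff) (metis UNIV_I imageE)
  moreover have "N \<inter> W = W"
    by (auto simp: W_def)
  ultimately have "homeomorphic_map (subtopology (subtopology M N) W) (top_of_set (ball (g y) e)) g"
    using homeomorphic_map_subtopologies[OF g, of W "ball (g y) e"] N by simp
  then have "homeomorphic_map (subtopology M W) (top_of_set (ball (g y) e)) g"
    by (simp add: subtopology_subtopology \<open>N \<inter> W = W\<close>)
  moreover obtain k where "homeomorphic_map (top_of_set (ball (g y) e)) euclideanreal k"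
  proof -
    obtain k l where "homeomorphism (ball (g y) e) (UNIV :: real set) k l"
      using homeomorphic_ball_UNIV[OF e(1), of "g y"] unfolding homeomorphic_def by blast
    then have "homeomorphic_maps (top_of_set (ball (g y) e)) euclideanreal k l"
      by (auto simp: homeomorphic_maps_def homeomorphism_def continuous_map_in_subtopology)
    then show ?thesis
      using that homeomorphic_map_maps by blast
  qed
  ultimately have "homeomorphic_map (subtopology M W) euclideanreal (k \<circ> g)"
    using homeomorphic_map_compose by blast
  then show ?thesis
    using that W by blast
qed

lemma chart_separates_points:
  assumes W: "openin M W" and f: "homeomorphic_map (subtopology M W) euclideanreal f"
    and "x \<in> W" "z \<in> W" "x \<noteq> z"
  shows "separable_points M x z"
proof -
  have "Hausdorff_space (subtopology M W)"
    using f homeomorphic_map_imp_homeomorphic_space homeomorphic_Hausdorff_space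
      Hausdorff_space_euclidean by blast
  moreover have "topspace (subtopology M W) = W"
    using W openin_subset by fastforce
  ultimately obtain U V where "openin (subtopology M W) U" "openin (subtopology M W) V"
      "x \<in> U" "z \<in> V" "disjnt U V"
    using assms(3-5) unfolding Hausdorff_space_def by metis
  then show ?thesis
    unfolding separable_points_def using W openin_open_subtopology by blast
qed

lemma chart_around_disjoint_NH:
  assumes "openin M W" "homeomorphic_map (subtopology M W) euclideanreal f" "x \<in> W"
  shows "W \<inter> NH M x = {}"
  using chart_separates_points[OF assms] unfolding NH_def by blast

lemma NH_closedin:
  assumes M: "one_manifold M" and x: "x \<in> topspace M"
  shows "closedin M (NH M x)"
proof -
  have "\<exists>V. openin M V \<and> z \<in> V \<and> V \<subseteq> topspace M - NH M x" if z: "z \<in> topspace M - NH M x" for z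
  proof (cases "z = x")
    case True
    then show ?thesis
      using one_manifold_open_chart[OF M x] chart_around_disjoint_NH openin_subset
      by (metis Diff_eq Int_subset_iff disjoint_eq_subset_Compl)
  next
    case False
    then obtain U V where UV: "openin M U" "openin M V" "x \<in> U" "z \<in> V" "disjnt U V"
      using z unfolding NH_def separable_points_def by blast
    then have "V \<inter> NH M x = {}"
      unfolding NH_def separable_points_def by blast
    then show ?thesis
      using UV openin_subset by blast
  qed
  then have "openin M (topspace M - NH M x)"
    by (subst openin_subopen) blast
  then show ?thesis
    by (simp add: closedin_def NH_def subset_iff)
qed

text \<open>
  An open set around a point inseparable from \<open>x\<close> meets every chart around \<open>x\<close>, and such a chart
  contains no point of \<open>NH M x\<close>.
\<close>

lemma open_not_subset_NH:
  assumes M: "one_manifold M" and x: "x \<in> topspace M"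
    and W: "openin M W" "y \<in> W" "y \<in> NH M x"
  shows "\<not> W \<subseteq> NH M x"
proof -
  obtain V f where V: "openin M V" "x \<in> V" "homeomorphic_map (subtopology M V) euclideanreal f"
    using one_manifold_open_chart[OF M x] .
  have "V \<inter> W \<noteq> {}"
    using W V unfolding NH_def separable_points_def disjnt_def by blast
  then show ?thesis
    using chart_around_disjoint_NH[OF V(1,3,2)] by blast
qed

lemma NH_subset_topspace: "NH M x \<subseteq> topspace M"
  by (auto simp: NH_def)

lemma separable_points_homeomorphic_image:
  assumes h: "homeomorphic_map M M' h" and "separable_points M x y"
  shows "separable_points M' (h x) (h y)"
proof -
  obtain U V where UV: "openin M U" "openin M V" "x \<in> U" "y \<in> V" "disjnt U V"
    using assms(2) unfolding separable_points_def by blast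
  then have sub: "U \<subseteq> topspace M" "V \<subseteq> topspace M"
    using openin_subset by blast+
  have "inj_on h (topspace M)"
    using h by (simp add: homeomorphic_eq_everything_map)
  then have "disjnt (h ` U) (h ` V)"
    using UV(5) sub by (metis disjnt_def image_empty inj_on_image_Int)
  moreover have "openin M' (h ` U)" "openin M' (h ` V)"
    using homeomorphic_map_openness[OF h] UV(1,2) sub by blast+
  ultimately show ?thesis
    unfolding separable_points_def using UV(3,4) by blast
qed

lemma NH_homeomorphic_image:
  assumes h: "homeomorphic_map M M' h" and x: "x \<in> topspace M"
  shows "h ` NH M x = NH M' (h x)"
proof -
  obtain g where "homeomorphic_maps M M' h g"
    using h homeomorphic_map_maps by blast
  then have g: "homeomorphic_map M' M g" and gh: "\<And>z. z \<in> topspace M \<Longrightarrow> g (h z) = z"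
    by (auto simp: homeomorphic_maps_map homeomorphic_maps_def)
  have sep: "separable_points M' (h x) (h y) \<longleftrightarrow> separable_points M x y" if "y \<in> topspace M" for y
    using separable_points_homeomorphic_image[OF h, of x y]
      separable_points_homeomorphic_image[OF g, of "h x" "h y"] gh x that by auto
  have surj: "h ` topspace M = topspace M'"
    using homeomorphic_imp_surjective_map[OF h] .
  show ?thesis
    using sep gh x unfolding NH_def surj[symmetric] by (auto simp: image_iff) metis+
qed

section \<open>Homogeneous sets of inseparable points\<close>

theorem proposition4p16:
  fixes M :: "'a topology" and x :: 'a
  assumes "one_manifold M"
    and "\<not> Hausdorff_space M"
    and "x \<in> topspace M"
    and "\<And>y0 y1. y0 \<in> NH M x \<Longrightarrow> y1 \<in> NH M x \<Longrightarrow>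
           \<exists>h. homeomorphic_map M M h \<and> h x = x \<and> h y0 = y1"
    and "NH M x \<noteq> {}"
  shows "subtopology M (NH M x) = discrete_topology (NH M x)"
proof -
  let ?S = "NH M x"
  note S = NH_subset_topspace[of M x]
  obtain y where y: "y \<in> ?S"
    using assms(5) by blast
  then obtain W f where W: "openin M W" "y \<in> W"
    and f: "homeomorphic_map (subtopology M W) euclideanreal f"
    using one_manifold_open_chart assms(1) S by (metis subsetD)
  have topW: "topspace (subtopology M W) = W"
    using openin_subset[OF W(1)] by auto
  have inj: "inj_on f W" and surj: "f ` W = UNIV"
    using f topW by (simp_all add: homeomorphic_eq_everything_map)
  define A where "A = f ` (W \<inter> ?S)"

  \<comment> \<open>Both properties transported by the homeomorphisms can be read off in the chart.\<close>
  have acc_iff: "accessible_point euclideanreal A (f z) \<longleftrightarrow> accessible_point M ?S z" if "z \<in> W" for z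
    unfolding A_def
    using accessible_point_homeomorphic_image_iff[OF f, of "W \<inter> ?S" z]
      accessible_point_open_subtopology[OF W(1) that] that unfolding topW by simp
  have derived: "euclideanreal derived_set_of A = f ` (W \<inter> M derived_set_of ?S)"
  proof -
    have "euclideanreal derived_set_of A = f ` (W \<inter> M derived_set_of (W \<inter> (W \<inter> ?S)))"
      unfolding A_def using homeomorphic_map_derived_set_of[OF f, of "W \<inter> ?S"]
      unfolding topW by (simp add: derived_set_of_subtopology)
    moreover have "W \<inter> M derived_set_of (W \<inter> ?S) = W \<inter> M derived_set_of ?S"
      using openin_Int_derived_set_of_subset[OF W(1), of ?S] derived_set_of_mono[of "W \<inter> ?S" ?S M]
      by blast
    ultimately show ?thesis
      by (simp add: Int_absorb)
  qed

  have "closedin (subtopology M W) (W \<inter> ?S)"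
    using NH_closedin[OF assms(1,3)] by (auto simp: closedin_subtopology)
  then have "closed A"
    using homeomorphic_map_closedness[OF f, of "W \<inter> ?S"] unfolding topW A_def by simp
  moreover have "A \<noteq> {}"
    using W(2) y by (auto simp: A_def)
  moreover have "A \<noteq> UNIV"
  proof
    assume "A = UNIV"
    then have "W \<inter> ?S = W"
      using inj_on_image_eq_iff[OF inj, of "W \<inter> ?S" W] surj by (simp add: A_def)
    then show False
      using open_not_subset_NH[OF assms(1,3) W y] by blast
  qed
  ultimately obtain a where a: "a \<in> W" "a \<in> ?S" "accessible_point M ?S a"
    using exists_accessible_point_real[of A] acc_iff unfolding A_def by blast

  have all_accessible: "accessible_point M ?S z" if z: "z \<in> ?S" for z
  proof -
    obtain h where h: "homeomorphic_map M M h" "h x = x" "h a = z"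
      using assms(4)[OF a(2) z] by blast
    then show ?thesis
      using accessible_point_homeomorphic_image[OF h(1) S _ a(3)] a(2) S
        NH_homeomorphic_image[OF h(1) assms(3)] by auto
  qed
  then have "{t \<in> A. accessible_point euclideanreal A t} = A"
    using acc_iff by (auto simp: A_def)
  then have "countable A"
    using countable_accessible_points_real[of A] by simp
  then obtain b where b: "b \<in> ?S" "b \<notin> M derived_set_of ?S"
    using countable_closed_real_has_isolated_point[OF \<open>closed A\<close> _ \<open>A \<noteq> {}\<close>] derived
    unfolding A_def by blast

  have "z \<notin> M derived_set_of ?S" if z: "z \<in> ?S" for z
  proof -
    obtain h where h: "homeomorphic_map M M h" "h x = x" "h z = b"
      using assms(4)[OF z b(1)] by blast
    then have "M derived_set_of ?S = h ` (M derived_set_of ?S)"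
      using homeomorphic_map_derived_set_of[OF h(1) S] NH_homeomorphic_image[OF h(1) assms(3)] by simp
    then show ?thesis
      using b(2) h(3) by blast
  qed
  then show ?thesis
    using S by (auto simp: subtopology_eq_discrete_topology_eq)
qed

end
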